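(* Let $(\Omega,\mathcal{F},\mathbb{P})$ be a probability space, $n\in\mathbb{N}$, and let $\tilde\rho:\operatorname{int}_{\|\cdot\|_\infty}\big(L^\infty_+(\Omega;\mathbb{R}^n)\big)\to(0,\infty)^n$ be a pointwise positively homogeneous return risk measure. Then $\tilde\rho$ is separable.
   Context: $L^\infty_+(\Omega;\mathbb{R}^n)$ is the cone of essentially bounded $\mathbb{R}^n$-valued random vectors with a.s. nonnegative components, with norm $\|\mathbf{X}\|_\infty=\max_i\operatorname{ess\,sup}|\mathbf{X}_i|$; its interior equals $E^n$ with $E=\operatorname{int}_{\|\cdot\|_\infty}(L^\infty_+)$, the set of essentially bounded random variables that are a.s. bounded below by a positive constant. A return risk measure on a cone $C$ with values in $[0,\infty]^k$ is a map that is monotone ($x\le y$ a.s. componentwise implies $\tilde\rho(x)\le\tilde\rho(y)$ componentwise) and positively homogeneous ($\tilde\rho(\lambda x)=\lambda\tilde\rho(x)$ for $\lambda\in(0,\infty)$). $\tilde\rho$ is pointwise positively homogeneous if $\tilde\rho(z\mathbf{X})=z\tilde\rho(\mathbf{X})$ for all $\mathbf{X}\in E^n$, $z\in(0,\infty)^n$, with componentwise multiplication. $\tilde\rho$ is separable if there are (real-valued) return risk measures $\tilde r_1,\dots,\tilde r_n$ on $E$ with $\tilde\rho(\mathbf{X})=(\tilde r_1(\mathbf{X}_1),\dots,\tilde r_n(\mathbf{X}_n))^\intercal$ for all $\mathbf{X}\in E^n$. *)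

theory Defs
  imports "HOL-Probability.Probability"
begin

(* Random variables are represented by measurable functions, not by classes modulo almost sure
   equality.  Nothing is lost: Linf_norm, Linf, Linf_plus and Linf_interior only depend on
   almost sure classes, and a return risk measure, being monotone for the almost sure order,
   takes the same value on almost surely equal elements of its cone.

   The value space is an ordered Euclidean space 'b.  For 'b = real ^ 'n the basis vectors
   are the unit vectors and the order is componentwise; for 'b = real this is the scalar case. *)

definition Linf_norm :: "'a measure \<Rightarrow> ('a \<Rightarrow> 'b::euclidean_space) \<Rightarrow> ereal" where
  "Linf_norm M X = (MAX b\<in>Basis. esssup M (\<lambda>\<omega>. ereal \<bar>X \<omega> \<bullet> b\<bar>))"

definition Linf :: "'a measure \<Rightarrow> ('a \<Rightarrow> 'b::euclidean_space) set" where
  "Linf M = {X \<in> borel_measurable M. Linf_norm M X < \<infinity>}"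

definition Linf_plus :: "'a measure \<Rightarrow> ('a \<Rightarrow> 'b::ordered_euclidean_space) set" where
  "Linf_plus M = {X \<in> Linf M. AE \<omega> in M. 0 \<le> X \<omega>}"

definition Linf_interior ::
  "'a measure \<Rightarrow> ('a \<Rightarrow> 'b::euclidean_space) set \<Rightarrow> ('a \<Rightarrow> 'b) set" where
  "Linf_interior M C =
     {X \<in> C. \<exists>\<epsilon>>0. \<forall>Y\<in>Linf M. Linf_norm M (\<lambda>\<omega>. Y \<omega> - X \<omega>) < ereal \<epsilon> \<longrightarrow> Y \<in> C}"

definition E_cone :: "'a measure \<Rightarrow> ('a \<Rightarrow> real) set" where
  "E_cone M = Linf_interior M (Linf_plus M)"

definition E_cone_power :: "'a measure \<Rightarrow> ('a \<Rightarrow> real ^ 'n) set" where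
  "E_cone_power M = {X. \<forall>i. (\<lambda>\<omega>. X \<omega> $ i) \<in> E_cone M}"

(* Values lie in [0, \<infinity>]^k, componentwise; only the values on C matter. *)

definition return_risk_measure ::
  "'a measure \<Rightarrow> ('a \<Rightarrow> 'b::ordered_euclidean_space) set \<Rightarrow>
   (('a \<Rightarrow> 'b) \<Rightarrow> ennreal ^ 'k) \<Rightarrow> bool" where
  "return_risk_measure M C \<rho> \<longleftrightarrow>
     (\<forall>X\<in>C. \<forall>Y\<in>C. (AE \<omega> in M. X \<omega> \<le> Y \<omega>) \<longrightarrow> (\<forall>j. \<rho> X $ j \<le> \<rho> Y $ j)) \<and>
     (\<forall>X\<in>C. \<forall>c::real. 0 < c \<longrightarrow>
        (\<forall>j. \<rho> (\<lambda>\<omega>. c *\<^sub>R X \<omega>) $ j = ennreal c * \<rho> X $ j))"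

definition pointwise_pos_homogeneous ::
  "'a measure \<Rightarrow> (('a \<Rightarrow> real ^ 'n) \<Rightarrow> ennreal ^ 'n) \<Rightarrow> bool" where
  "pointwise_pos_homogeneous M \<rho> \<longleftrightarrow>
     (\<forall>X\<in>E_cone_power M. \<forall>z::real ^ 'n. (\<forall>i. 0 < z $ i) \<longrightarrow>
        \<rho> (\<lambda>\<omega>. \<chi> i. z $ i * X \<omega> $ i) = (\<chi> i. ennreal (z $ i) * \<rho> X $ i))"

(* The marginal measures r i are return risk measures with k = 1; the finiteness condition
   says that they are real-valued. *)

definition separable_risk_measure ::
  "'a measure \<Rightarrow> (('a \<Rightarrow> real ^ 'n) \<Rightarrow> ennreal ^ 'n) \<Rightarrow> bool" where
  "separable_risk_measure M \<rho> \<longleftrightarrow>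
     (\<exists>r :: 'n \<Rightarrow> ('a \<Rightarrow> real) \<Rightarrow> ennreal ^ 1.
        (\<forall>i. return_risk_measure M (E_cone M) (r i) \<and> (\<forall>Y\<in>E_cone M. r i Y $ 1 < \<infinity>)) \<and>
        (\<forall>X\<in>E_cone_power M. \<rho> X = (\<chi> i. r i (\<lambda>\<omega>. X \<omega> $ i) $ 1)))"

lemma Linf_norm_AE: "b \<in> Basis \<Longrightarrow> AE \<omega> in M. ereal \<bar>X \<omega> \<bullet> b\<bar> \<le> Linf_norm M X"
proof -
  assume b: "b \<in> Basis"
  have le: "esssup M (\<lambda>\<omega>. ereal \<bar>X \<omega> \<bullet> b\<bar>) \<le> Linf_norm M X"
    unfolding Linf_norm_def using b by (intro Max_ge) auto
  show ?thesis
    using esssup_AE[of "\<lambda>\<omega>. ereal \<bar>X \<omega> \<bullet> b\<bar>" M] le by (auto elim!: eventually_mono)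
qed

lemma Linf_norm_le:
  assumes [measurable]: "X \<in> borel_measurable M"
    and "\<And>b. b \<in> Basis \<Longrightarrow> AE \<omega> in M. \<bar>X \<omega> \<bullet> b\<bar> \<le> c"
  shows "Linf_norm M X \<le> ereal c"
  unfolding Linf_norm_def using assms(2)
  by (subst Max_le_iff) (auto intro!: esssup_I)

lemma Linf_iff:
  "X \<in> Linf M \<longleftrightarrow> X \<in> borel_measurable M \<and> (\<exists>c. \<forall>b\<in>Basis. AE \<omega> in M. \<bar>X \<omega> \<bullet> b\<bar> \<le> c)"
proof
  assume X: "X \<in> Linf M"
  then have fin: "Linf_norm M X < \<infinity>" by (simp add: Linf_def)
  then obtain c where c: "Linf_norm M X \<le> ereal c"
    by (cases "Linf_norm M X") auto
  have "\<forall>b\<in>Basis. AE \<omega> in M. \<bar>X \<omega> \<bullet> b\<bar> \<le> c"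
  proof
    fix b :: 'b assume "b \<in> Basis"
    from Linf_norm_AE[OF this, of X M] show "AE \<omega> in M. \<bar>X \<omega> \<bullet> b\<bar> \<le> c"
      by eventually_elim (use c order_trans in fastforce)
  qed
  with X show "X \<in> borel_measurable M \<and> (\<exists>c. \<forall>b\<in>Basis. AE \<omega> in M. \<bar>X \<omega> \<bullet> b\<bar> \<le> c)"
    by (auto simp: Linf_def)
next
  assume "X \<in> borel_measurable M \<and> (\<exists>c. \<forall>b\<in>Basis. AE \<omega> in M. \<bar>X \<omega> \<bullet> b\<bar> \<le> c)"
  then obtain c where "X \<in> borel_measurable M" "\<forall>b\<in>Basis. AE \<omega> in M. \<bar>X \<omega> \<bullet> b\<bar> \<le> c" by auto
  then have "X \<in> borel_measurable M" "Linf_norm M X \<le> ereal c" by (auto intro!: Linf_norm_le)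
  then show "X \<in> Linf M" by (auto simp: Linf_def)
qed

lemma Linf_interior_plus_iff:
  fixes X :: "'a \<Rightarrow> 'b::ordered_euclidean_space"
  shows "X \<in> Linf_interior M (Linf_plus M) \<longleftrightarrow>
    X \<in> Linf M \<and> (\<exists>c>0. \<forall>b\<in>Basis. AE \<omega> in M. c \<le> X \<omega> \<bullet> b)"
proof
  assume "X \<in> Linf_interior M (Linf_plus M)"
  then obtain e where e: "e > 0" and X: "X \<in> Linf M"
    and *: "\<And>Y. Y \<in> Linf M \<Longrightarrow> Linf_norm M (\<lambda>\<omega>. Y \<omega> - X \<omega>) < ereal e \<Longrightarrow> Y \<in> Linf_plus M"
    by (auto simp: Linf_interior_def Linf_plus_def)
  define Y where "Y = (\<lambda>\<omega>. X \<omega> - (e / 2) *\<^sub>R One)"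
  have Yb: "Y \<omega> \<bullet> b = X \<omega> \<bullet> b - e / 2" if "b \<in> Basis" for b \<omega>
    using that by (simp add: Y_def inner_diff_left)
  obtain c where Xm: "X \<in> borel_measurable M" and c: "\<forall>b\<in>Basis. AE \<omega> in M. \<bar>X \<omega> \<bullet> b\<bar> \<le> c"
    using X by (auto simp: Linf_iff)
  have Ym: "Y \<in> borel_measurable M" unfolding Y_def using Xm by simp
  have "\<forall>b\<in>Basis. AE \<omega> in M. \<bar>Y \<omega> \<bullet> b\<bar> \<le> c + e / 2"
  proof
    fix b :: 'b assume b: "b \<in> Basis"
    with c have "AE \<omega> in M. \<bar>X \<omega> \<bullet> b\<bar> \<le> c" by blast
    then show "AE \<omega> in M. \<bar>Y \<omega> \<bullet> b\<bar> \<le> c + e / 2"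
      by eventually_elim (use e Yb[OF b] in \<open>simp add: abs_le_iff; linarith\<close>)
  qed
  then have YL: "Y \<in> Linf M" using Ym by (auto simp: Linf_iff)
  have "Linf_norm M (\<lambda>\<omega>. Y \<omega> - X \<omega>) \<le> ereal (e / 2)"
    using Xm Ym e by (intro Linf_norm_le) (auto simp: inner_diff_left Yb)
  also have "\<dots> < ereal e" using e by simp
  finally have "Y \<in> Linf_plus M" using * YL by blast
  then have nn: "AE \<omega> in M. 0 \<le> Y \<omega>" by (simp add: Linf_plus_def)
  have "\<forall>b\<in>Basis. AE \<omega> in M. e / 2 \<le> X \<omega> \<bullet> b"
  proof
    fix b :: 'b assume b: "b \<in> Basis"
    show "AE \<omega> in M. e / 2 \<le> X \<omega> \<bullet> b"
      using nn by eventually_elim (use b Yb[OF b] in \<open>auto simp: eucl_le[where 'a='b]\<close>)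
  qed
  then show "X \<in> Linf M \<and> (\<exists>c>0. \<forall>b\<in>Basis. AE \<omega> in M. c \<le> X \<omega> \<bullet> b)"
    using X e half_gt_zero by blast
next
  assume "X \<in> Linf M \<and> (\<exists>c>0. \<forall>b\<in>Basis. AE \<omega> in M. c \<le> X \<omega> \<bullet> b)"
  then obtain c where X: "X \<in> Linf M" and c: "c > 0"
    and lb: "\<forall>b\<in>Basis. AE \<omega> in M. c \<le> X \<omega> \<bullet> b" by auto
  have *: "Y \<in> Linf_plus M" if Y: "Y \<in> Linf M"
    and d: "Linf_norm M (\<lambda>\<omega>. Y \<omega> - X \<omega>) < ereal c" for Y
  proof -
    have "\<forall>b\<in>Basis. AE \<omega> in M. 0 \<le> Y \<omega> \<bullet> b"
    proof
      fix b :: 'b assume b: "b \<in> Basis"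
      from lb b have "AE \<omega> in M. c \<le> X \<omega> \<bullet> b" by blast
      with Linf_norm_AE[OF b, of "\<lambda>\<omega>. Y \<omega> - X \<omega>" M] show "AE \<omega> in M. 0 \<le> Y \<omega> \<bullet> b"
      proof eventually_elim
        case (elim \<omega>)
        from elim(1) d have "ereal \<bar>(Y \<omega> - X \<omega>) \<bullet> b\<bar> < ereal c" by (rule le_less_trans)
        then have "\<bar>Y \<omega> \<bullet> b - X \<omega> \<bullet> b\<bar> < c" by (simp add: inner_diff_left)
        with elim(2) show ?case by linarith
      qed
    qed
    then have "AE \<omega> in M. \<forall>b\<in>Basis. 0 \<le> Y \<omega> \<bullet> b"
      by (simp add: AE_finite_all)
    then show ?thesis using Y by (simp add: Linf_plus_def eucl_le[where 'a='b])
  qed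
  have "X \<in> Linf_plus M"
  proof -
    have "Linf_norm M (\<lambda>\<omega>. X \<omega> - X \<omega>) \<le> ereal 0" by (intro Linf_norm_le) auto
    also have "\<dots> < ereal c" using c by simp
    finally show ?thesis using * X by blast
  qed
  with * c show "X \<in> Linf_interior M (Linf_plus M)" by (auto simp: Linf_interior_def)
qed

lemma E_cone_iff:
  "Y \<in> E_cone M \<longleftrightarrow>
    Y \<in> borel_measurable M \<and> (\<exists>C. AE \<omega> in M. \<bar>Y \<omega>\<bar> \<le> C) \<and> (\<exists>c>0. AE \<omega> in M. c \<le> Y \<omega>)"
  by (simp add: E_cone_def Linf_interior_plus_iff Linf_iff)

lemma Linf_interior_plus_eq_E_cone_power:
  "Linf_interior M (Linf_plus M) = (E_cone_power M :: ('a \<Rightarrow> real ^ 'n) set)"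
proof (intro set_eqI iffI)
  fix X :: "'a \<Rightarrow> real ^ 'n"
  assume "X \<in> Linf_interior M (Linf_plus M)"
  then obtain C c where m: "X \<in> borel_measurable M"
    and C: "\<forall>b\<in>Basis. AE \<omega> in M. \<bar>X \<omega> \<bullet> b\<bar> \<le> C"
    and c: "c > 0" "\<forall>b\<in>Basis. AE \<omega> in M. c \<le> X \<omega> \<bullet> b"
    by (auto simp: Linf_interior_plus_iff Linf_iff)
  show "X \<in> E_cone_power M"
    unfolding E_cone_power_def E_cone_iff
  proof (intro CollectI allI conjI)
    fix i :: 'n
    have b: "axis i 1 \<in> (Basis :: (real ^ 'n) set)" by (simp add: axis_in_Basis_iff)
    have eq: "X \<omega> \<bullet> axis i 1 = X \<omega> $ i" for \<omega> by (simp add: inner_axis)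
    have "(\<lambda>\<omega>. X \<omega> \<bullet> axis i 1) \<in> borel_measurable M" using m by simp
    then show "(\<lambda>\<omega>. X \<omega> $ i) \<in> borel_measurable M" by (simp add: eq)
    show "\<exists>C. AE \<omega> in M. \<bar>X \<omega> $ i\<bar> \<le> C" using bspec[OF C b] by (auto simp: eq)
    show "\<exists>c>0. AE \<omega> in M. c \<le> X \<omega> $ i" using bspec[OF c(2) b] c(1) by (auto simp: eq)
  qed
next
  fix X :: "'a \<Rightarrow> real ^ 'n"
  assume "X \<in> E_cone_power M"
  then have m: "\<And>i. (\<lambda>\<omega>. X \<omega> $ i) \<in> borel_measurable M"
    and "\<forall>i. \<exists>C. AE \<omega> in M. \<bar>X \<omega> $ i\<bar> \<le> C" "\<forall>i. \<exists>c>0. AE \<omega> in M. c \<le> X \<omega> $ i"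
    by (auto simp: E_cone_power_def E_cone_iff)
  then obtain C c where C: "\<And>i. AE \<omega> in M. \<bar>X \<omega> $ i\<bar> \<le> C i"
    and c: "\<And>i. c i > (0::real)" "\<And>i. AE \<omega> in M. c i \<le> X \<omega> $ i"
    by metis
  have "X \<in> borel_measurable M"
    using m by (subst borel_measurable_euclidean_space) (auto simp: Basis_vec_def inner_axis)
  moreover have "AE \<omega> in M. \<bar>X \<omega> $ i\<bar> \<le> Max (range C)" for i
    using C[of i] by eventually_elim (meson Max_ge UNIV_I finite_class.finite_UNIV finite_imageI imageI order_trans)
  moreover have "AE \<omega> in M. Min (range c) \<le> X \<omega> $ i" for i
    using c(2)[of i] by eventually_elim (meson Min_le UNIV_I finite_class.finite_UNIV finite_imageI imageI order_trans)
  moreover have "Min (range c) > 0" using c(1) by simp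
  ultimately have "X \<in> borel_measurable M"
    "\<exists>C. \<forall>i. AE \<omega> in M. \<bar>X \<omega> $ i\<bar> \<le> C" "\<exists>c>0. \<forall>i. AE \<omega> in M. c \<le> X \<omega> $ i"
    by blast+
  then show "X \<in> Linf_interior M (Linf_plus M)"
    by (simp add: Linf_interior_plus_iff Linf_iff Basis_vec_def inner_axis)
qed

end

theory Submission
  imports Defs
begin

text \<open>Since multiplying every coordinate of \<open>X\<close> except the \<open>i\<close>-th by a small constant does not
  change the \<open>i\<close>-th component of \<open>\<rho> X\<close>, and essential bounds allow these coordinates to be pushed
  below those of any other \<open>Y\<close>, monotonicity of that component only requires \<open>X\<^sub>i \<le> Y\<^sub>i\<close>. The
  marginals are then the components of \<open>\<rho>\<close> on the diagonal \<open>(Y, \<dots>, Y)\<close>.\<close>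

text \<open>\<open>Y\<close> is essentially bounded above and \<open>Z\<close> is bounded away from
  zero, so a ratio of these two bounds serves as \<open>t\<close>.\<close>

lemma E_cone_dominate_by_scaling:
  assumes "Y \<in> E_cone M" and "Z \<in> E_cone M"
  shows "\<exists>t>0. AE \<omega> in M. t * Y \<omega> \<le> Z \<omega>"
proof -
  obtain C where C: "AE \<omega> in M. \<bar>Y \<omega>\<bar> \<le> C"
    using assms(1) by (auto simp: E_cone_iff)
  obtain c where c: "c > 0" "AE \<omega> in M. c \<le> Z \<omega>"
    using assms(2) by (auto simp: E_cone_iff)
  \<comment> \<open>The sign of \<open>C\<close> is not recorded, and it may be negative when
    \<open>M\<close> is the null measure; the absolute value and the added 1 keep the denominator
    positive.\<close>
  define t where "t = c / (\<bar>C\<bar> + 1)"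
  have t: "t > 0"
    using c(1) by (simp add: t_def add_nonneg_pos)
  have "AE \<omega> in M. t * Y \<omega> \<le> Z \<omega>"
    using C c(2)
  proof eventually_elim
    case (elim \<omega>)
    have "t * Y \<omega> \<le> t * (\<bar>C\<bar> + 1)"
      using t elim(1) by (intro mult_left_mono) auto
    also have "\<dots> = c"
      by (simp add: t_def add_nonneg_eq_0_iff)
    finally show ?case
      using elim(2) by simp
  qed
  with t show ?thesis by blast
qed

lemma E_cone_mult_const:
  assumes "Y \<in> E_cone M" and "c > 0"
  shows "(\<lambda>\<omega>. c * Y \<omega>) \<in> E_cone M"
proof -
  obtain C d where m: "Y \<in> borel_measurable M" and C: "AE \<omega> in M. \<bar>Y \<omega>\<bar> \<le> C"
    and d: "d > 0" "AE \<omega> in M. d \<le> Y \<omega>"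
    using assms(1) by (auto simp: E_cone_iff)
  have "AE \<omega> in M. \<bar>c * Y \<omega>\<bar> \<le> c * C"
    using C by eventually_elim (use assms(2) in \<open>simp add: abs_mult\<close>)
  moreover have "AE \<omega> in M. c * d \<le> c * Y \<omega>"
    using d(2) by eventually_elim (use assms(2) in simp)
  moreover have "c * d > 0"
    using assms(2) d(1) by simp
  ultimately show ?thesis
    using m unfolding E_cone_iff by (intro conjI exI[of _ "c * C"] exI[of _ "c * d"]) simp_all
qed

text \<open>Used in both directions, this shows that component \<open>i\<close> of
  \<open>\<rho> X\<close> depends only on coordinate \<open>i\<close> of \<open>X\<close>.\<close>

lemma pointwise_pos_homogeneous_component_mono:
  fixes \<rho> :: "('a \<Rightarrow> real ^ 'n) \<Rightarrow> ennreal ^ 'n"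
  assumes rrm: "return_risk_measure M (E_cone_power M) \<rho>"
    and pph: "pointwise_pos_homogeneous M \<rho>"
    and X: "X \<in> E_cone_power M" and Y: "Y \<in> E_cone_power M"
    and le: "AE \<omega> in M. X \<omega> $ i \<le> Y \<omega> $ i"
  shows "\<rho> X $ i \<le> \<rho> Y $ i"
proof -
  have "\<exists>t>0. AE \<omega> in M. t * X \<omega> $ j \<le> Y \<omega> $ j" for j
    using X Y by (intro E_cone_dominate_by_scaling) (simp_all add: E_cone_power_def)
  then obtain t where t: "\<And>j. t j > (0::real)"
    and tle: "\<And>j. AE \<omega> in M. t j * X \<omega> $ j \<le> Y \<omega> $ j"
    by metis
  \<comment> \<open>The entry 1 at \<open>i\<close> leaves both coordinate \<open>i\<close> of
    \<open>X\<close> and component \<open>i\<close> of \<open>\<rho> X\<close> unchanged, while the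
    other entries push \<open>X\<close> below \<open>Y\<close>.\<close>
  define z :: "real ^ 'n" where "z = (\<chi> j. if j = i then 1 else t j)"
  have z: "0 < z $ j" for j
    using t by (simp add: z_def)
  define Z where "Z = (\<lambda>\<omega>. \<chi> j. z $ j * X \<omega> $ j)"
  have "Z \<in> E_cone_power M"
    using X z by (auto simp: E_cone_power_def Z_def intro!: E_cone_mult_const)
  moreover have "AE \<omega> in M. Z \<omega> \<le> Y \<omega>"
  proof -
    have "AE \<omega> in M. Z \<omega> $ j \<le> Y \<omega> $ j" for j
      using le tle[of j] by (cases "j = i") (simp_all add: Z_def z_def)
    \<comment> \<open>There are finitely many coordinates, so the exceptional null sets can be
      united.\<close>
    then show ?thesis
      unfolding less_eq_vec_def by (intro eventually_all_finite)
  qed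
  ultimately have "\<rho> Z $ i \<le> \<rho> Y $ i"
    using rrm Y by (simp add: return_risk_measure_def)
  moreover have "\<rho> Z = (\<chi> j. ennreal (z $ j) * \<rho> X $ j)"
    using pph X z by (simp add: pointwise_pos_homogeneous_def Z_def)
  ultimately show ?thesis
    by (simp add: z_def)
qed

theorem corollary5p2:
  fixes M :: "'a measure" and \<rho> :: "('a \<Rightarrow> real ^ 'n) \<Rightarrow> ennreal ^ 'n"
  assumes "prob_space M"
    and "return_risk_measure M (Linf_interior M (Linf_plus M)) \<rho>"
    and "\<forall>X \<in> Linf_interior M (Linf_plus M). \<forall>i. 0 < \<rho> X $ i \<and> \<rho> X $ i < \<infinity>"
    and "pointwise_pos_homogeneous M \<rho>"
  shows "separable_risk_measure M \<rho>"
proof -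
  note rrm = assms(2)[unfolded Linf_interior_plus_eq_E_cone_power]
  note fin = assms(3)[unfolded Linf_interior_plus_eq_E_cone_power]
  note mono = pointwise_pos_homogeneous_component_mono[OF rrm assms(4)]
  \<comment> \<open>Repeating \<open>Y\<close> in every coordinate makes \<open>D\<close> commute
    with scalar multiplication, so each \<open>r i\<close> inherits positive homogeneity from
    \<open>\<rho>\<close>.\<close>
  define D :: "('a \<Rightarrow> real) \<Rightarrow> 'a \<Rightarrow> real ^ 'n" where "D Y = (\<lambda>\<omega>. \<chi> j. Y \<omega>)" for Y
  define r :: "'n \<Rightarrow> ('a \<Rightarrow> real) \<Rightarrow> ennreal ^ 1" where "r i Y = (\<chi> k. \<rho> (D Y) $ i)" for i Y
  have D: "D Y \<in> E_cone_power M" if "Y \<in> E_cone M" for Y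
    using that by (simp add: D_def E_cone_power_def)
  have D_scale: "D (\<lambda>\<omega>. c *\<^sub>R Y \<omega>) = (\<lambda>\<omega>. c *\<^sub>R D Y \<omega>)" for c Y
    by (simp add: D_def fun_eq_iff vec_eq_iff)
  have r_hom: "\<rho> (D (\<lambda>\<omega>. c *\<^sub>R Y \<omega>)) $ i = ennreal c * \<rho> (D Y) $ i"
    if "Y \<in> E_cone M" "0 < c" for i c Y
    using rrm D[OF that(1)] that(2) unfolding D_scale return_risk_measure_def by blast
  have "return_risk_measure M (E_cone M) (r i)" for i
    unfolding return_risk_measure_def
  proof (intro conjI ballI allI impI)
    fix X Y and k :: 1
    assume "X \<in> E_cone M" "Y \<in> E_cone M" "AE \<omega> in M. X \<omega> \<le> Y \<omega>"
    then show "r i X $ k \<le> r i Y $ k"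
      using mono[OF D D] by (simp add: r_def D_def)
  next
    fix X and c :: real and k :: 1
    assume "X \<in> E_cone M" "0 < c"
    then show "r i (\<lambda>\<omega>. c *\<^sub>R X \<omega>) $ k = ennreal c * r i X $ k"
      unfolding r_def by (simp only: vec_lambda_beta r_hom)
  qed
  moreover have "r i Y $ 1 < \<infinity>" if "Y \<in> E_cone M" for i Y
    using fin D[OF that] by (simp add: r_def)
  moreover have "\<rho> X = (\<chi> i. r i (\<lambda>\<omega>. X \<omega> $ i) $ 1)" if X: "X \<in> E_cone_power M" for X
  proof -
    have "D (\<lambda>\<omega>. X \<omega> $ i) \<in> E_cone_power M" for i
      using X by (intro D) (simp add: E_cone_power_def)
    \<comment> \<open>Both arguments have the same coordinate \<open>i\<close>, so
      \<open>mono\<close> gives the two inequalities.\<close>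
    then have "\<rho> X $ i = \<rho> (D (\<lambda>\<omega>. X \<omega> $ i)) $ i" for i
      using X by (intro antisym mono) (simp_all add: D_def)
    then show ?thesis
      by (simp add: vec_eq_iff r_def)
  qed
  ultimately show ?thesis
    unfolding separable_risk_measure_def by blast
qed

end
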